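(* Let $a,b,c\in\mathbb{C}(t)$ with $a\neq 0$, and suppose that the Riccati equation $y'=ay^2+by+c$ has no solution in $\mathbb{C}(t)^{alg}$. Let $y_0,y_1,y_2\in\mathcal{U}$ be three distinct solutions of $y'=ay^2+by+c$. Then $\mathrm{tr.deg}_{\mathbb{C}(t)}\,\mathbb{C}(t)(y_0,y_1,y_2)=3$, that is, $y_0,y_1,y_2$ are algebraically independent over $\mathbb{C}(t)$.
   Context: $\mathcal{U}$ is a fixed saturated model of $DCF_0$, the theory of differentially closed fields of characteristic $0$ with a single derivation $\partial$ (also written $'$). Its field of constants is $\mathbb{C}$, and $t\in\mathcal{U}$ is an element with $\partial(t)=1$. The superscript $alg$ denotes algebraic closure (inside $\mathcal{U}$). *)

theory Defs
  imports
    Complex_Main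
    "HOL-Library.Poly_Mapping"
    "HOL-Computational_Algebra.Polynomial"
begin

section \<open>Subfields, algebraic elements, algebraic independence\<close>

definition is_subfield :: "'u::field set \<Rightarrow> bool" where
  "is_subfield K \<longleftrightarrow>
     0 \<in> K \<and> 1 \<in> K \<and>
     (\<forall>x\<in>K. \<forall>y\<in>K. x + y \<in> K \<and> x * y \<in> K) \<and>
     (\<forall>x\<in>K. - x \<in> K \<and> inverse x \<in> K)"

definition adjoin :: "'u::field set \<Rightarrow> 'u set \<Rightarrow> 'u set" where
  "adjoin K S = is_subfield hull (K \<union> S)"

definition alg_closure_in :: "'u::field set \<Rightarrow> 'u set" where
  "alg_closure_in K = {x. \<exists>p. p \<noteq> 0 \<and> (\<forall>i. coeff p i \<in> K) \<and> poly p x = 0}"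

text \<open>
  A multivariate polynomial over \<open>'u\<close> with variables named by \<open>'v\<close> is a finitely supported
  map from monomials to coefficients, a monomial being a finitely supported map from variables
  to exponents.
\<close>

type_synonym ('v, 'u) mpol = "('v \<Rightarrow>\<^sub>0 nat) \<Rightarrow>\<^sub>0 'u"

definition mpol_vars :: "('v, 'u::zero) mpol \<Rightarrow> 'v set" where
  "mpol_vars p = (\<Union>m\<in>Poly_Mapping.keys p. Poly_Mapping.keys m)"

definition mpol_eval :: "('v \<Rightarrow> 'u) \<Rightarrow> ('v, 'u::comm_semiring_1) mpol \<Rightarrow> 'u" where
  "mpol_eval f p = (\<Sum>m\<in>Poly_Mapping.keys p.
     Poly_Mapping.lookup p m * (\<Prod>v\<in>Poly_Mapping.keys m. f v ^ Poly_Mapping.lookup m v))"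

text \<open>The elements of \<open>S\<close> name the variables, and each variable is evaluated at itself.\<close>

definition alg_independent :: "'u::field set \<Rightarrow> 'u set \<Rightarrow> bool" where
  "alg_independent K S \<longleftrightarrow>
     (\<forall>p :: ('u, 'u) mpol.
        mpol_vars p \<subseteq> S \<and> (\<forall>m. Poly_Mapping.lookup p m \<in> K) \<and>
        mpol_eval (\<lambda>s. s) p = 0
        \<longrightarrow> p = 0)"

definition transcendence_basis :: "'u::field set \<Rightarrow> 'u set \<Rightarrow> 'u set \<Rightarrow> bool" where
  "transcendence_basis K L B \<longleftrightarrow>
     B \<subseteq> L \<and> alg_independent K B \<and> L \<subseteq> alg_closure_in (adjoin K B)"

text \<open>
  All transcendence bases of an extension have the same cardinality, so for a given extension
  this holds for at most one \<open>n\<close>.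
\<close>

definition has_trdeg :: "'u::field set \<Rightarrow> 'u set \<Rightarrow> nat \<Rightarrow> bool" where
  "has_trdeg K L n \<longleftrightarrow> (\<exists>B. transcendence_basis K L B \<and> finite B \<and> card B = n)"

section \<open>Differentially closed fields of characteristic zero\<close>

definition is_derivation :: "('u::field \<Rightarrow> 'u) \<Rightarrow> bool" where
  "is_derivation D \<longleftrightarrow>
     (\<forall>x y. D (x + y) = D x + D y) \<and> (\<forall>x y. D (x * y) = D x * y + x * D y)"

definition constants :: "('u::field \<Rightarrow> 'u) \<Rightarrow> 'u set" where
  "constants D = {x. D x = 0}"

text \<open>A differential polynomial in one indeterminate \<open>X\<close>: variable \<open>i\<close> stands for \<open>X\<^sup>(\<^sup>i\<^sup>)\<close>.\<close>

type_synonym 'u dpol = "(nat, 'u) mpol"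

definition dpol_order :: "'u::zero dpol \<Rightarrow> int" where
  "dpol_order f = (if mpol_vars f = {} then - 1 else int (Max (mpol_vars f)))"

definition dpol_eval :: "('u::field \<Rightarrow> 'u) \<Rightarrow> 'u dpol \<Rightarrow> 'u \<Rightarrow> 'u" where
  "dpol_eval D f x = mpol_eval (\<lambda>i. (D ^^ i) x) f"

text \<open>
  Blum's axioms. The case of \<open>f\<close> of order 0 and \<open>g\<close> of order \<open>-1\<close> (a nonzero element of the
  field) says that the field is algebraically closed.
\<close>

definition model_DCF0 :: "('u::field_char_0 \<Rightarrow> 'u) \<Rightarrow> bool" where
  "model_DCF0 D \<longleftrightarrow>
     is_derivation D \<and>
     (\<forall>f g :: 'u dpol. g \<noteq> 0 \<and> dpol_order g < dpol_order f \<longrightarrow>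
        (\<exists>x. dpol_eval D f x = 0 \<and> dpol_eval D g x \<noteq> 0))"

section \<open>Saturation\<close>

unbundle cardinal_syntax

text \<open>First-order formulas with parameters in the language of differential rings.\<close>

datatype 'u dterm =
    Var nat
  | Param 'u
  | Zero
  | One
  | Add "'u dterm" "'u dterm"
  | Minus "'u dterm"
  | Mult "'u dterm" "'u dterm"
  | Der "'u dterm"

datatype 'u dform =
    Equal "'u dterm" "'u dterm"
  | FNot "'u dform"
  | FAnd "'u dform" "'u dform"
  | FEx nat "'u dform"

primrec term_val :: "('u::field \<Rightarrow> 'u) \<Rightarrow> (nat \<Rightarrow> 'u) \<Rightarrow> 'u dterm \<Rightarrow> 'u" where
  "term_val D v (Var i) = v i"
| "term_val D v (Param a) = a"
| "term_val D v Zero = 0"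
| "term_val D v One = 1"
| "term_val D v (Add s t) = term_val D v s + term_val D v t"
| "term_val D v (Minus s) = - term_val D v s"
| "term_val D v (Mult s t) = term_val D v s * term_val D v t"
| "term_val D v (Der s) = D (term_val D v s)"

primrec satisfies :: "('u::field \<Rightarrow> 'u) \<Rightarrow> (nat \<Rightarrow> 'u) \<Rightarrow> 'u dform \<Rightarrow> bool" where
  "satisfies D v (Equal s t) \<longleftrightarrow> term_val D v s = term_val D v t"
| "satisfies D v (FNot \<phi>) \<longleftrightarrow> \<not> satisfies D v \<phi>"
| "satisfies D v (FAnd \<phi> \<psi>) \<longleftrightarrow> satisfies D v \<phi> \<and> satisfies D v \<psi>"
| "satisfies D v (FEx i \<phi>) \<longleftrightarrow> (\<exists>a. satisfies D (v(i := a)) \<phi>)"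

primrec term_vars :: "'u dterm \<Rightarrow> nat set" where
  "term_vars (Var i) = {i}"
| "term_vars (Param a) = {}"
| "term_vars Zero = {}"
| "term_vars One = {}"
| "term_vars (Add s t) = term_vars s \<union> term_vars t"
| "term_vars (Minus s) = term_vars s"
| "term_vars (Mult s t) = term_vars s \<union> term_vars t"
| "term_vars (Der s) = term_vars s"

primrec free_vars :: "'u dform \<Rightarrow> nat set" where
  "free_vars (Equal s t) = term_vars s \<union> term_vars t"
| "free_vars (FNot \<phi>) = free_vars \<phi>"
| "free_vars (FAnd \<phi> \<psi>) = free_vars \<phi> \<union> free_vars \<psi>"
| "free_vars (FEx i \<phi>) = free_vars \<phi> - {i}"

text \<open>
  An \<open>n\<close>-type over \<open>A\<close> is a set of formulas with parameters in \<open>A\<close> and free variables among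
  the first \<open>n\<close> that is finitely satisfiable in the field itself. The structure is saturated if
  every \<open>n\<close>-type over every parameter set of smaller cardinality than the field is realized.
  The function \<open>set_dform\<close> generated by the datatype package gives the parameters of a formula.
\<close>

definition is_type :: "('u::field \<Rightarrow> 'u) \<Rightarrow> 'u set \<Rightarrow> nat \<Rightarrow> 'u dform set \<Rightarrow> bool" where
  "is_type D A n \<Gamma> \<longleftrightarrow>
     (\<forall>\<phi>\<in>\<Gamma>. set_dform \<phi> \<subseteq> A \<and> free_vars \<phi> \<subseteq> {..<n}) \<and>
     (\<forall>F. finite F \<and> F \<subseteq> \<Gamma> \<longrightarrow> (\<exists>v. \<forall>\<phi>\<in>F. satisfies D v \<phi>))"

definition saturated :: "('u::field \<Rightarrow> 'u) \<Rightarrow> bool" where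
  "saturated D \<longleftrightarrow>
     (\<forall>A n \<Gamma>. |A| <o |UNIV :: 'u set| \<and> is_type D A n \<Gamma> \<longrightarrow>
        (\<exists>v. \<forall>\<phi>\<in>\<Gamma>. satisfies D v \<phi>))"

section \<open>Identification of the constants with the complex numbers\<close>

text \<open>A unital ring homomorphism out of a field is injective.\<close>

definition is_field_hom :: "('k::field \<Rightarrow> 'u::field) \<Rightarrow> bool" where
  "is_field_hom h \<longleftrightarrow>
     h 1 = 1 \<and> (\<forall>x y. h (x + y) = h x + h y) \<and> (\<forall>x y. h (x * y) = h x * h y)"

end

theory Submission
  imports Defs
begin

text \<open>
  For two solutions \<open>y\<^sub>0 \<noteq> y\<close> of the Riccati equation, \<open>u = 1 / (y - y\<^sub>0)\<close> solves the linear equation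
  \<open>u' = h u - a\<close> with \<open>h = - (2 a y\<^sub>0 + b)\<close>, so that the difference \<open>w = u\<^sub>2 - u\<^sub>1\<close> of two such
  elements solves \<open>w' = h w\<close>. If \<open>u\<^sub>1\<close> were algebraic over \<open>K(y\<^sub>0)\<close>, its trace would give a solution
  of the linear equation in \<open>K(y\<^sub>0)\<close>. If \<open>w\<close> were algebraic over \<open>K(y\<^sub>0, u\<^sub>1)\<close>, its norm would give
  some \<open>v \<noteq> 0\<close> with \<open>v' = n h v\<close> in \<open>K(y\<^sub>0, u\<^sub>1)\<close>. Both are excluded by looking at zeros and poles
  of rational functions: an algebraic point that does not itself solve the differential equation
  of the variable is not invariant under the derivation, so a nonzero order there drops by
  exactly one under differentiation. This forces \<open>v\<close> first into \<open>K(y\<^sub>0)\<close> and then into \<open>K\<close>, and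
  the solution of the linear equation to be a polynomial in \<open>y\<^sub>0\<close>, both of which are impossible
  because \<open>a \<noteq> 0\<close>.
\<close>

section \<open>Subfields and polynomials over them\<close>

lemma subfieldD:
  assumes "is_subfield L"
  shows subfield_0: "0 \<in> L" and subfield_1: "1 \<in> L"
    and subfield_add: "x \<in> L \<Longrightarrow> y \<in> L \<Longrightarrow> x + y \<in> L"
    and subfield_mult: "x \<in> L \<Longrightarrow> y \<in> L \<Longrightarrow> x * y \<in> L"
    and subfield_uminus: "x \<in> L \<Longrightarrow> - x \<in> L"
    and subfield_inverse: "x \<in> L \<Longrightarrow> inverse x \<in> L"
  using assms by (auto simp: is_subfield_def)

lemma subfield_diff: "is_subfield L \<Longrightarrow> x \<in> L \<Longrightarrow> y \<in> L \<Longrightarrow> x - y \<in> L"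
  using subfield_add[of L x "- y"] subfield_uminus[of L y] by simp

lemma subfield_divide: "is_subfield L \<Longrightarrow> x \<in> L \<Longrightarrow> y \<in> L \<Longrightarrow> x / y \<in> L"
  by (simp add: divide_inverse subfield_mult subfield_inverse)

lemma subfield_of_nat: "is_subfield L \<Longrightarrow> of_nat n \<in> L"
  by (induction n) (auto intro: subfieldD)

lemma subfield_numeral: "is_subfield L \<Longrightarrow> numeral n \<in> L"
  using subfield_of_nat[of L "numeral n"] by simp

lemma subfield_sum: "is_subfield L \<Longrightarrow> (\<And>i. i \<in> A \<Longrightarrow> f i \<in> L) \<Longrightarrow> sum f A \<in> L"
  by (induction A rule: infinite_finite_induct) (auto intro: subfieldD)

lemma subfield_prod: "is_subfield L \<Longrightarrow> (\<And>i. i \<in> A \<Longrightarrow> f i \<in> L) \<Longrightarrow> prod f A \<in> L"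
  by (induction A rule: infinite_finite_induct) (auto intro: subfieldD)

lemma subfield_power: "is_subfield L \<Longrightarrow> x \<in> L \<Longrightarrow> x ^ n \<in> L"
  by (induction n) (auto intro: subfieldD)

lemmas subfield_intros = subfieldD subfield_diff subfield_divide subfield_of_nat
  subfield_numeral subfield_sum subfield_prod subfield_power

lemma is_subfield_adjoin: "is_subfield (adjoin L S)"
  unfolding adjoin_def
  by (rule hull_in) (auto simp: is_subfield_def)

lemma adjoin_superset: "L \<subseteq> adjoin L S" "S \<subseteq> adjoin L S"
  using hull_subset[of "L \<union> S" is_subfield] by (auto simp: adjoin_def)

lemma adjoin_minimal: "is_subfield M \<Longrightarrow> L \<subseteq> M \<Longrightarrow> S \<subseteq> M \<Longrightarrow> adjoin L S \<subseteq> M"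
  unfolding adjoin_def by (rule hull_minimal) auto

section \<open>Polynomials with coefficients in a subfield\<close>

definition polys_over :: "'u::field set \<Rightarrow> 'u poly set" where
  "polys_over L = {p. \<forall>i. coeff p i \<in> L}"

lemma polys_over_coeff: "p \<in> polys_over L \<Longrightarrow> coeff p i \<in> L"
  by (simp add: polys_over_def)

lemma polys_over_pCons:
  "is_subfield L \<Longrightarrow> pCons x p \<in> polys_over L \<longleftrightarrow> x \<in> L \<and> p \<in> polys_over L"
  unfolding polys_over_def mem_Collect_eq
  by (metis coeff_pCons_0 coeff_pCons_Suc not0_implies_Suc)

lemma polys_over_ring:
  assumes "is_subfield L"
  shows "0 \<in> polys_over L" and "1 \<in> polys_over L"
    and "p \<in> polys_over L \<Longrightarrow> q \<in> polys_over L \<Longrightarrow> p + q \<in> polys_over L"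
    and "p \<in> polys_over L \<Longrightarrow> q \<in> polys_over L \<Longrightarrow> p - q \<in> polys_over L"
    and "p \<in> polys_over L \<Longrightarrow> - p \<in> polys_over L"
    and "p \<in> polys_over L \<Longrightarrow> q \<in> polys_over L \<Longrightarrow> p * q \<in> polys_over L"
    and "x \<in> L \<Longrightarrow> p \<in> polys_over L \<Longrightarrow> smult x p \<in> polys_over L"
  using assms by (auto simp: polys_over_def coeff_mult intro!: subfield_intros)

lemma polys_over_pderiv:
  "is_subfield L \<Longrightarrow> p \<in> polys_over L \<Longrightarrow> pderiv p \<in> polys_over L"
  unfolding polys_over_def coeff_pderiv mem_Collect_eq by (blast intro: subfield_intros)

lemma alg_closure_in_iff:
  "x \<in> alg_closure_in L \<longleftrightarrow> (\<exists>p\<in>polys_over L. p \<noteq> 0 \<and> poly p x = 0)"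
  by (auto simp: alg_closure_in_def polys_over_def)

lemma alg_closure_in_mono: "L \<subseteq> M \<Longrightarrow> alg_closure_in L \<subseteq> alg_closure_in M"
  by (auto simp: alg_closure_in_def)

lemma subset_alg_closure_in:
  assumes "is_subfield L"
  shows "L \<subseteq> alg_closure_in L"
proof
  fix x assume "x \<in> L"
  then have "[:- x, 1:] \<in> polys_over L"
    using assms by (simp add: polys_over_pCons polys_over_ring subfieldD)
  then show "x \<in> alg_closure_in L"
    unfolding alg_closure_in_iff by (rule bexI[rotated]) simp
qed

text \<open>Substituting \<open>X - z\<close> for the variable of an annihilating polynomial moves
  its root from \<open>x\<close> to \<open>x + z\<close> and keeps the coefficients in
  \<open>L\<close>.\<close>

lemma alg_closure_in_add:
  assumes L: "is_subfield L" and x: "x \<in> alg_closure_in L" and "z \<in> L"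
  shows "x + z \<in> alg_closure_in L"
proof -
  obtain p where p: "p \<in> polys_over L" "p \<noteq> 0" "poly p x = 0"
    using x by (auto simp: alg_closure_in_iff)
  have "q \<circ>\<^sub>p [:- z, 1:] \<in> polys_over L" if "q \<in> polys_over L" for q
    using that
  proof (induction q)
    case (pCons c q)
    then show ?case
      using L \<open>z \<in> L\<close> unfolding pcompose_pCons
      by (intro polys_over_ring) (auto simp: polys_over_pCons polys_over_ring subfieldD)
  qed (simp add: polys_over_ring L)
  moreover have "p \<circ>\<^sub>p [:- z, 1:] \<noteq> 0"
    using p(2) by (simp add: pcompose_eq_0_iff)
  moreover have "poly (p \<circ>\<^sub>p [:- z, 1:]) (x + z) = 0"
    using p(3) by (simp add: poly_pcompose)
  ultimately show ?thesis
    using p(1) by (auto simp: alg_closure_in_iff)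
qed

text \<open>Reversing the coefficients of an annihilating polynomial of \<open>x \<noteq> 0\<close>
  gives one for the inverse; for \<open>x = 0\<close> the convention \<open>inverse 0 = 0\<close>
  applies.\<close>

lemma alg_closure_in_inverse:
  assumes L: "is_subfield L" and x: "x \<in> alg_closure_in L"
  shows "inverse x \<in> alg_closure_in L"
proof (cases "x = 0")
  case False
  obtain p where p: "p \<in> polys_over L" "p \<noteq> 0" "poly p x = 0"
    using x by (auto simp: alg_closure_in_iff)
  have "reflect_poly p \<in> polys_over L"
    using p(1) L by (auto simp: polys_over_def coeff_reflect_poly subfieldD)
  moreover have "poly (reflect_poly p) (inverse x) = 0"
    using p(3) False by (simp add: poly_reflect_poly_nz)
  moreover have "reflect_poly p \<noteq> 0"
    using p(2) by simp
  ultimately show ?thesis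
    unfolding alg_closure_in_iff by blast
qed (use x in simp)

text \<open>The fractions \<open>poly p y / poly q y\<close> form a subfield containing
  \<open>L\<close> and \<open>y\<close>, so minimality of \<open>adjoin\<close> puts
  \<open>v\<close> among them.\<close>

lemma adjoin_singleton_fraction:
  assumes L: "is_subfield L" and v: "v \<in> adjoin L {y}"
  obtains p q where "p \<in> polys_over L" "q \<in> polys_over L" "poly q y \<noteq> 0"
    "v = poly p y / poly q y"
proof -
  define M where "M = {poly p y / poly q y | p q.
    p \<in> polys_over L \<and> q \<in> polys_over L \<and> poly q y \<noteq> 0}"
  have MI: "v \<in> M" if "p \<in> polys_over L" "q \<in> polys_over L" "poly q y \<noteq> 0"
      "v = poly p y / poly q y" for v p q
    using that by (auto simp: M_def)
  have ring: "x + z \<in> M" "x * z \<in> M" if xz: "x \<in> M" "z \<in> M" for x z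
  proof -
    obtain p q where 1: "p \<in> polys_over L" "q \<in> polys_over L" "poly q y \<noteq> 0"
      "x = poly p y / poly q y"
      using xz(1) unfolding M_def by blast
    obtain r s where 2: "r \<in> polys_over L" "s \<in> polys_over L" "poly s y \<noteq> 0"
      "z = poly r y / poly s y"
      using xz(2) unfolding M_def by blast
    note * = 1 2
    show "x + z \<in> M"
      by (rule MI[of "p * s + r * q" "q * s"])
        (use * L in \<open>auto simp: polys_over_ring add_frac_eq\<close>)
    show "x * z \<in> M"
      by (rule MI[of "p * r" "q * s"]) (use * L in \<open>auto simp: polys_over_ring\<close>)
  qed
  have inv: "- x \<in> M" "inverse x \<in> M" if xM: "x \<in> M" for x
  proof -
    obtain p q where *: "p \<in> polys_over L" "q \<in> polys_over L" "poly q y \<noteq> 0"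
      "x = poly p y / poly q y"
      using xM unfolding M_def by blast
    show "- x \<in> M"
      by (rule MI[of "- p" q]) (use * L in \<open>auto simp: polys_over_ring\<close>)
    show "inverse x \<in> M"
    proof (cases "poly p y = 0")
      case True
      then show ?thesis using * xM by simp
    next
      case False
      show ?thesis by (rule MI[of q p]) (use * False in auto)
    qed
  qed
  have const: "x \<in> M" if "x \<in> L" for x
    by (rule MI[of "[:x:]" 1]) (use that L in \<open>auto simp: polys_over_pCons polys_over_ring\<close>)
  have "y \<in> M"
    by (rule MI[of "[:0, 1:]" 1])
      (use L in \<open>auto simp: polys_over_pCons polys_over_ring subfieldD\<close>)
  moreover have "is_subfield M"
    unfolding is_subfield_def
    by (simp add: ring inv const subfield_0[OF L] subfield_1[OF L])
  ultimately have "adjoin L {y} \<subseteq> M"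
    using const by (intro adjoin_minimal) auto
  then show thesis
    using v that unfolding M_def by blast
qed

text \<open>Induction on the degree of \<open>q\<close>: a root of \<open>q\<close> is a root of
  \<open>p\<close>, and cancelling the common linear factor lowers both orders alike.\<close>

lemma dvd_of_order_le:
  fixes p q :: "'u::field poly"
  assumes closed: "\<forall>p :: 'u poly. degree p > 0 \<longrightarrow> (\<exists>x. poly p x = 0)"
    and "p \<noteq> 0" and "q \<noteq> 0" and "\<And>x. order x q \<le> order x p"
  shows "q dvd p"
  using assms(2-)
proof (induction "degree q" arbitrary: p q)
  case 0
  then obtain c where "q = [:c:]" by (metis degree_eq_zeroE)
  then show ?case using \<open>q \<noteq> 0\<close> by (simp add: const_poly_dvd_iff dvd_field_iff)
next
  case (Suc n)
  obtain x where x: "poly q x = 0" using closed Suc.hyps(2) by (metis zero_less_Suc)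
  then have "poly p x = 0"
    using Suc.prems by (metis order_root le_zero_eq)
  obtain r where r: "q = [:- x, 1:] * r" using x by (auto simp: poly_eq_0_iff_dvd)
  obtain s where s: "p = [:- x, 1:] * s"
    using \<open>poly p x = 0\<close> by (auto simp: poly_eq_0_iff_dvd)
  have nz: "r \<noteq> 0" "s \<noteq> 0" using r s Suc.prems by auto
  have "order z r \<le> order z s" for z
    using Suc.prems(3)[of z] order_mult[of "[:- x, 1:]" r z] order_mult[of "[:- x, 1:]" s z]
      Suc.prems(1,2) unfolding r s by linarith
  moreover have "n = degree r"
    using Suc.hyps(2) nz degree_mult_eq[of "[:- x, 1:]" r] unfolding r by simp
  ultimately have "r dvd s" using Suc.hyps(1)[of r s] nz by simp
  then show ?case unfolding r s by (rule mult_dvd_mono[OF dvd_refl])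
qed

section \<open>Derivations\<close>

locale derivation =
  fixes D :: "'u::field_char_0 \<Rightarrow> 'u"
  assumes D_add: "D (x + y) = D x + D y"
    and D_mult: "D (x * y) = D x * y + x * D y"
begin

lemma D_0 [simp]: "D 0 = 0"
  using D_add[of 0 0] by simp

lemma D_1 [simp]: "D 1 = 0"
  using D_mult[of 1 1] by simp

lemma D_uminus: "D (- x) = - D x"
  using D_add[of x "- x"] by (simp add: add_eq_0_iff)

lemma D_diff: "D (x - y) = D x - D y"
  using D_add[of x "- y"] by (simp add: D_uminus)

lemma D_of_nat [simp]: "D (of_nat n) = 0"
  by (induction n) (simp_all add: D_add)

lemma D_sum: "D (sum f A) = (\<Sum>i\<in>A. D (f i))"
  by (induction A rule: infinite_finite_induct) (simp_all add: D_add)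

lemma D_inverse: "x \<noteq> 0 \<Longrightarrow> D (inverse x) = - D x / x\<^sup>2"
proof -
  assume "x \<noteq> 0"
  then have "D x * inverse x + x * D (inverse x) = 0"
    using D_mult[of x "inverse x"] by simp
  then show ?thesis
    using \<open>x \<noteq> 0\<close> by (simp add: field_simps power2_eq_square add_eq_0_iff)
qed

lemma D_divide: "y \<noteq> 0 \<Longrightarrow> D (x / y) = (D x * y - x * D y) / y\<^sup>2"
  by (simp add: divide_inverse D_mult D_inverse) (simp add: field_simps power2_eq_square)

text \<open>The elements of the extension whose derivative stays in it form a subfield, so only
  generators need checking.\<close>

lemma adjoin_D_closed:
  assumes "D ` L \<subseteq> adjoin L S" and "D ` S \<subseteq> adjoin L S"
  shows "D ` adjoin L S \<subseteq> adjoin L S"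
proof -
  let ?A = "adjoin L S"
  have A: "is_subfield ?A" by (rule is_subfield_adjoin)
  have inv: "D (inverse x) \<in> ?A" if "x \<in> ?A" "D x \<in> ?A" for x
    using that by (cases "x = 0") (auto simp: D_inverse intro!: subfield_intros[OF A])
  have "is_subfield {x \<in> ?A. D x \<in> ?A}"
    unfolding is_subfield_def
    by (auto simp: D_add D_mult D_uminus inv intro!: subfield_intros[OF A])
  then have "?A \<subseteq> {x \<in> ?A. D x \<in> ?A}"
    by (rule adjoin_minimal) (use assms adjoin_superset[of L S] adjoin_superset(2)[of S L] in auto)
  then show ?thesis by auto
qed

text \<open>The derivation of the polynomial ring that extends \<open>D\<close> and sends the variable to \<open>g\<close>.\<close>

definition poly_D :: "'u poly \<Rightarrow> 'u poly \<Rightarrow> 'u poly" where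
  "poly_D g p = map_poly D p + pderiv p * g"

lemma poly_poly_D:
  assumes "D x = poly g x"
  shows "poly (poly_D g p) x = D (poly p x)"
  unfolding poly_D_def using assms
  by (induction p) (simp_all add: map_poly_pCons pderiv_pCons D_add D_mult algebra_simps)

lemma map_poly_D_mult: "map_poly D (p * q) = map_poly D p * q + p * map_poly D q"
  by (rule poly_eqI) (simp add: coeff_map_poly coeff_mult D_sum D_mult sum.distrib)

lemma poly_D_mult: "poly_D g (p * q) = poly_D g p * q + p * poly_D g q"
  by (simp add: poly_D_def map_poly_D_mult pderiv_mult algebra_simps)

text \<open>The power rule multiplied by \<open>p\<close>, which avoids the exponent
  \<open>n - 1\<close> and its special case \<open>n = 0\<close>.\<close>

lemma poly_D_power: "p * poly_D g (p ^ n) = of_nat n * p ^ n * poly_D g p"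
proof (induction n)
  case 0
  then show ?case by (simp add: poly_D_def map_poly_1)
next
  case (Suc n)
  have "p * poly_D g (p ^ Suc n) = p * (p * poly_D g (p ^ n)) + p * p ^ n * poly_D g p"
    by (simp add: poly_D_mult algebra_simps)
  then show ?case unfolding Suc by (simp add: algebra_simps)
qed

lemma polys_over_poly_D:
  assumes "is_subfield L" "D ` L \<subseteq> L" "g \<in> polys_over L" "p \<in> polys_over L"
  shows "poly_D g p \<in> polys_over L"
proof -
  have "map_poly D p \<in> polys_over L"
    using assms by (auto simp: polys_over_def coeff_map_poly)
  then show ?thesis
    unfolding poly_D_def using assms by (intro polys_over_ring polys_over_pderiv)
qed

text \<open>
  Unless \<open>\<beta>\<close> solves \<open>y' = g(y)\<close>, the derivation lowers a positive order at \<open>\<beta>\<close> by one.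
  Hence \<open>p' q - p q'\<close> has the order of \<open>p q\<close> minus one, except when the orders of
  \<open>p\<close> and \<open>q\<close> cancel.
\<close>

lemma order_eq_of_wronskian_dvd:
  assumes nz: "p \<noteq> 0" "q \<noteq> 0" and \<beta>: "D \<beta> \<noteq> poly g \<beta>"
    and dvd: "[:- \<beta>, 1:] ^ (order \<beta> p + order \<beta> q) dvd poly_D g p * q - p * poly_D g q"
  shows "order \<beta> p = order \<beta> q"
proof -
  define X where "X = [:- \<beta>, 1:]"
  define e f where "e = order \<beta> p" and "f = order \<beta> q"
  obtain r where r: "p = X ^ e * r" "poly r \<beta> \<noteq> 0"
    using order_decomp[OF nz(1), of \<beta>] by (auto simp: X_def e_def poly_eq_0_iff_dvd)
  obtain s where s: "q = X ^ f * s" "poly s \<beta> \<noteq> 0"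
    using order_decomp[OF nz(2), of \<beta>] by (auto simp: X_def f_def poly_eq_0_iff_dvd)
  define R where "R = poly_D g r * s - r * poly_D g s"
  have X0: "poly X \<beta> = 0" "X \<noteq> 0" by (auto simp: X_def)
  have DX: "poly (poly_D g X) \<beta> = poly g \<beta> - D \<beta>"
    by (simp add: X_def poly_D_def map_poly_pCons pderiv_pCons D_uminus)
  \<comment> \<open>The extra factor \<open>X\<close> lets \<open>poly_D_power\<close> act on both
    powers of \<open>X\<close>, after which \<open>X ^ (e + f)\<close> factors out.\<close>
  have "X * (poly_D g p * q - p * poly_D g q)
      = (X * poly_D g (X ^ e)) * X ^ f * (r * s) - (X * poly_D g (X ^ f)) * X ^ e * (r * s)
        + X ^ e * X ^ f * X * R"
    unfolding r s R_def poly_D_mult by (simp add: algebra_simps)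
  also have "\<dots> = X ^ (e + f) * ((of_nat e - of_nat f) * poly_D g X * (r * s) + X * R)"
    unfolding poly_D_power power_add by (simp add: algebra_simps)
  finally have *: "X * (poly_D g p * q - p * poly_D g q)
      = X ^ (e + f) * ((of_nat e - of_nat f) * poly_D g X * (r * s) + X * R)" .
  obtain k where "poly_D g p * q - p * poly_D g q = X ^ (e + f) * k"
    using dvd unfolding X_def e_def f_def by (elim dvdE)
  with * have "X ^ (e + f) * (X * k)
      = X ^ (e + f) * ((of_nat e - of_nat f) * poly_D g X * (r * s) + X * R)"
    by (simp add: algebra_simps)
  then have "X * k = (of_nat e - of_nat f) * poly_D g X * (r * s) + X * R"
    using X0 by simp
  \<comment> \<open>At \<open>\<beta>\<close> all terms with a factor \<open>X\<close> vanish, while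
    \<open>poly_D g X\<close>, \<open>r\<close> and \<open>s\<close> do not; so \<open>e - f\<close>
    is zero in characteristic zero.\<close>
  then have "poly (X * k) \<beta> = poly ((of_nat e - of_nat f) * poly_D g X * (r * s) + X * R) \<beta>"
    by simp
  then have "(of_nat e - of_nat f :: 'u) = 0"
    using r s \<beta> by (simp add: X0 DX)
  then show ?thesis by (simp add: e_def f_def)
qed

text \<open>For \<open>v = p/q\<close> the equation makes the Wronskian equal to
  \<open>s * (p * q)\<close>, which has too high an order at every point unless the orders of
  \<open>p\<close> and \<open>q\<close> agree. So \<open>v\<close> has neither zeros nor poles as a
  rational function of \<open>y\<close>.\<close>

lemma in_base_if_logarithmic_derivative_polynomial:
  assumes closed: "\<forall>p :: 'u poly. degree p > 0 \<longrightarrow> (\<exists>x. poly p x = 0)"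
    and L: "is_subfield L" "D ` L \<subseteq> L" and y: "y \<notin> alg_closure_in L"
    and g: "g \<in> polys_over L" "D y = poly g y"
    and nosol: "\<And>\<beta>. \<beta> \<in> alg_closure_in L \<Longrightarrow> D \<beta> \<noteq> poly g \<beta>"
    and v: "v \<in> adjoin L {y}" "v \<noteq> 0" and s: "s \<in> polys_over L" "D v = poly s y * v"
  shows "v \<in> L"
proof -
  obtain p q where pq: "p \<in> polys_over L" "q \<in> polys_over L" "poly q y \<noteq> 0"
    "v = poly p y / poly q y"
    using adjoin_singleton_fraction[OF L(1) v(1)] .
  have nz: "p \<noteq> 0" "q \<noteq> 0" "poly p y \<noteq> 0" using pq v by auto
  define W where "W = poly_D g p * q - p * poly_D g q"
  have "poly W y / (poly q y)\<^sup>2 = poly s y * v"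
    using s(2) pq(3) unfolding pq(4) W_def by (simp add: poly_poly_D[OF g(2)] D_divide)
  then have "poly W y = poly s y * v * (poly q y)\<^sup>2"
    using pq(3) by (simp add: nonzero_divide_eq_eq)
  \<comment> \<open>A polynomial over \<open>L\<close> vanishing at the transcendental
    \<open>y\<close> is zero, so the relation at \<open>y\<close> lifts to a polynomial
    identity.\<close>
  then have "poly (W - s * (p * q)) y = 0"
    using pq(3) by (simp add: pq(4) power2_eq_square)
  moreover have "W - s * (p * q) \<in> polys_over L"
    unfolding W_def using L g pq s by (intro polys_over_ring polys_over_poly_D) auto
  ultimately have "W - s * (p * q) = 0"
    using y by (auto simp: alg_closure_in_iff)
  then have W: "W = s * (p * q)" by simp
  have ord: "order \<beta> p = order \<beta> q" for \<beta>
  proof (cases "\<beta> \<in> alg_closure_in L")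
    \<comment> \<open>Roots of \<open>p\<close> and \<open>q\<close> are algebraic over
      \<open>L\<close>, so both orders are 0 here.\<close>
    case False
    then have "poly p \<beta> \<noteq> 0" "poly q \<beta> \<noteq> 0"
      using pq nz by (auto simp: alg_closure_in_iff)
    then show ?thesis by (simp add: order_0I)
  next
    case True
    have "[:- \<beta>, 1:] ^ (order \<beta> p + order \<beta> q) dvd W"
      unfolding W power_add by (intro dvd_mult mult_dvd_mono order_1)
    then show ?thesis
      using order_eq_of_wronskian_dvd nz nosol[OF True] unfolding W_def by blast
  qed
  have "q dvd p" "p dvd q"
    using nz ord by (auto intro!: dvd_of_order_le[OF closed])
  then obtain k where k: "p = q * k" "is_unit k"
    using nz by (metis dvd_def dvd_times_left_cancel_iff mult.right_neutral)
  then obtain c where c: "k = [:c:]" by (metis is_unit_polyE)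
  \<comment> \<open>A priori \<open>c\<close> lies only in the ambient field; as a quotient of
    leading coefficients it lies in \<open>L\<close>.\<close>
  have "c = lead_coeff p / lead_coeff q"
    using nz k c by (simp add: lead_coeff_mult)
  moreover have "v = c"
    using pq k c by simp
  ultimately show ?thesis
    using L pq by (auto intro!: subfield_intros polys_over_coeff)
qed

section \<open>Norms and traces of algebraic solutions of linear equations\<close>

lemma coeff_poly_D_linear:
  "coeff (poly_D [:k, h:] p) i = D (coeff p i) + of_nat (Suc i) * coeff p (Suc i) * k
     + of_nat i * coeff p i * h"
  unfolding poly_D_def
  by (cases i) (simp_all add: coeff_map_poly coeff_pderiv algebra_simps)

text \<open>For the monic minimal polynomial \<open>p\<close>, \<open>poly_D [:k, h:] p\<close> also
  vanishes at \<open>x\<close> and has leading term \<open>degree p * h\<close> in degree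
  \<open>degree p\<close>. Subtracting that multiple of \<open>p\<close> leaves a smaller degree,
  hence zero by minimality.\<close>

lemma linear_equation_minimal_polynomial:
  assumes L: "is_subfield L" "D ` L \<subseteq> L" and x: "x \<in> alg_closure_in L"
    and hk: "h \<in> L" "k \<in> L" "D x = h * x + k"
  obtains p where "p \<in> polys_over L" "lead_coeff p = 1" "degree p > 0" "poly p x = 0"
    "poly_D [:k, h:] p = smult (of_nat (degree p) * h) p"
    "\<And>q. q \<in> polys_over L \<Longrightarrow> poly q x = 0 \<Longrightarrow> degree q < degree p \<Longrightarrow> q = 0"
proof -
  obtain p0 where p0: "p0 \<in> polys_over L" "p0 \<noteq> 0" "poly p0 x = 0"
    and min0: "\<And>q. q \<in> polys_over L \<Longrightarrow> q \<noteq> 0 \<Longrightarrow> poly q x = 0 \<Longrightarrow> degree p0 \<le> degree q"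
    using x ex_has_least_nat[of "\<lambda>p. p \<in> polys_over L \<and> p \<noteq> 0 \<and> poly p x = 0" _ degree]
    unfolding alg_closure_in_iff by blast
  define p where "p = smult (inverse (lead_coeff p0)) p0"
  have p: "p \<in> polys_over L" "lead_coeff p = 1" "poly p x = 0" "degree p = degree p0"
    using p0 L unfolding p_def
    by (auto intro!: polys_over_ring subfield_intros polys_over_coeff)
  have "degree p > 0"
  proof (rule ccontr)
    assume "\<not> degree p > 0"
    then obtain c where "p = [:c:]" by (metis degree_eq_zeroE not_gr_zero)
    then show False using p by simp
  qed
  have min: "q = 0" if "q \<in> polys_over L" "poly q x = 0" "degree q < degree p" for q
    using min0[of q] that p by auto
  define q where "q = poly_D [:k, h:] p - smult (of_nat (degree p) * h) p"
  have coeff_q: "coeff q i = D (coeff p i) + of_nat (Suc i) * coeff p (Suc i) * k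
      + of_nat i * coeff p i * h - of_nat (degree p) * h * coeff p i" for i
    unfolding q_def by (simp add: coeff_poly_D_linear)
  have "coeff q i = 0" if "i \<ge> degree p" for i
    using that p(2) unfolding coeff_q
    by (cases "i = degree p") (auto simp: coeff_eq_0)
  \<comment> \<open>Positivity of \<open>degree p\<close> covers \<open>q = 0\<close>, whose degree
    is 0 by convention.\<close>
  then have "degree q < degree p"
    using \<open>degree p > 0\<close> by (metis leading_coeff_0_iff degree_0 not_less)
  moreover have "q \<in> polys_over L"
    unfolding q_def using L hk p
    by (intro polys_over_ring polys_over_poly_D subfield_intros)
      (auto simp: polys_over_pCons polys_over_ring)
  moreover have "poly q x = 0"
    using p(3) hk(3) unfolding q_def by (simp add: poly_poly_D)
  ultimately have "q = 0" using min by blast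
  then show thesis
    using that[of p] p \<open>degree p > 0\<close> min unfolding q_def by auto
qed

text \<open>Up to sign, \<open>v\<close> is the norm of \<open>x\<close>: the constant coefficient
  of its minimal polynomial, whose degree is \<open>n\<close>.\<close>

lemma algebraic_exponential:
  assumes L: "is_subfield L" "D ` L \<subseteq> L" and x: "x \<in> alg_closure_in L" "x \<noteq> 0"
    and h: "h \<in> L" "D x = h * x"
  obtains n v where "n > 0" "v \<in> L" "v \<noteq> 0" "D v = of_nat n * h * v"
proof -
  obtain p where p: "p \<in> polys_over L" "lead_coeff p = 1" "degree p > 0" "poly p x = 0"
    "poly_D [:0, h:] p = smult (of_nat (degree p) * h) p"
    "\<And>q. q \<in> polys_over L \<Longrightarrow> poly q x = 0 \<Longrightarrow> degree q < degree p \<Longrightarrow> q = 0"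
    using linear_equation_minimal_polynomial[OF L x(1) h(1) subfield_0[OF L(1)]] h(2)
    by (metis add_0_right)
  have "coeff p 0 \<noteq> 0"
  proof
    \<comment> \<open>Since \<open>x \<noteq> 0\<close>, dividing by the variable would give an
      annihilating polynomial of smaller degree.\<close>
    assume "coeff p 0 = 0"
    then obtain q where q: "p = pCons 0 q" by (cases p) simp
    have "q \<noteq> 0" using p(3) q by auto
    moreover have "q \<in> polys_over L" using p(1) L q by (simp add: polys_over_pCons)
    moreover have "poly q x = 0" using p(4) q x by simp
    moreover have "degree q < degree p" using q \<open>q \<noteq> 0\<close> by simp
    ultimately show False using p(6) by blast
  qed
  moreover have "D (coeff p 0) = of_nat (degree p) * h * coeff p 0"
    using arg_cong[OF p(5), of "\<lambda>q. coeff q 0"] by (simp add: coeff_poly_D_linear)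
  ultimately show thesis
    using that p(1,3) polys_over_coeff by blast
qed

text \<open>The mean of the conjugates of \<open>x\<close>, its trace divided by the degree, solves
  the same equation; it is read off the coefficient just below the leading one of the minimal
  polynomial.\<close>

lemma algebraic_linear_equation:
  assumes L: "is_subfield L" "D ` L \<subseteq> L" and x: "x \<in> alg_closure_in L"
    and hk: "h \<in> L" "k \<in> L" "D x = h * x + k"
  obtains u where "u \<in> L" "D u = h * u + k"
proof -
  obtain p where p: "p \<in> polys_over L" "lead_coeff p = 1" "degree p > 0"
    "poly_D [:k, h:] p = smult (of_nat (degree p) * h) p"
    using linear_equation_minimal_polynomial[OF L x hk] by metis
  define n where "n = degree p - 1"
  have n: "degree p = Suc n" using p(3) by (simp add: n_def)
  define c where "c = coeff p n"
  have "D c + of_nat (Suc n) * k + of_nat n * c * h = of_nat (Suc n) * h * c"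
    using arg_cong[OF p(4), of "\<lambda>q. coeff q n"] p(2)
    unfolding coeff_poly_D_linear n c_def by simp
  then have Dc: "D c = h * c - of_nat (Suc n) * k"
    by (simp add: algebra_simps eq_diff_eq)
  define u where "u = - c / of_nat (Suc n)"
  have "D u = - D c / of_nat (Suc n)"
    unfolding u_def D_divide[OF of_nat_neq_0] D_of_nat D_uminus
    by (simp add: power2_eq_square del: of_nat_Suc)
  also have "\<dots> = h * u + k"
    unfolding Dc u_def using of_nat_neq_0[of n, where ?'a = 'u]
    by (simp add: field_simps del: of_nat_Suc)
  finally have "D u = h * u + k" .
  moreover have "u \<in> L"
    unfolding u_def c_def using L p by (intro subfield_intros polys_over_coeff)
  ultimately show thesis using that by blast
qed

text \<open>
  The equation for \<open>u\<close> is the one satisfied by \<open>1 / (z - y)\<close> for a second solution \<open>z\<close> of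
  the Riccati equation. A pole of \<open>u\<close> would gain an order under the derivation, so \<open>u\<close> is a
  polynomial in \<open>y\<close>, and then the leading coefficients disagree.
\<close>

lemma riccati_linearization_no_rational_solution:
  assumes closed: "\<forall>p :: 'u poly. degree p > 0 \<longrightarrow> (\<exists>x. poly p x = 0)"
    and L: "is_subfield L" "D ` L \<subseteq> L" and y: "y \<notin> alg_closure_in L"
    and abc: "a \<in> L" "b \<in> L" "c \<in> L" "a \<noteq> 0" and Dy: "D y = a * y\<^sup>2 + b * y + c"
    and nosol: "\<And>\<beta>. \<beta> \<in> alg_closure_in L \<Longrightarrow> D \<beta> \<noteq> a * \<beta>\<^sup>2 + b * \<beta> + c"
    and u: "u \<in> adjoin L {y}"
  shows "D u \<noteq> - (2 * a * y + b) * u - a"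
proof
  assume Du: "D u = - (2 * a * y + b) * u - a"
  define g where "g = [:c, b, a:]"
  \<comment> \<open>The coefficient of \<open>u\<close> in its linear equation, as a polynomial in
    \<open>y\<close>.\<close>
  define H where "H = [:- b, - 2 * a:]"
  have poly_g: "poly g x = a * x\<^sup>2 + b * x + c" for x
    by (simp add: g_def algebra_simps power2_eq_square)
  have g: "g \<in> polys_over L" "D y = poly g y"
    using abc L Dy by (simp_all add: poly_g) (simp add: g_def polys_over_pCons polys_over_ring)
  have H: "H \<in> polys_over L" "poly H y = - (2 * a * y + b)"
    using abc L by (auto simp: H_def polys_over_pCons polys_over_ring intro!: subfield_intros)
  obtain p q where pq: "p \<in> polys_over L" "q \<in> polys_over L" "poly q y \<noteq> 0"
    "u = poly p y / poly q y"
    using adjoin_singleton_fraction[OF L(1) u] .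
  have "u \<noteq> 0" using Du abc(4) by auto
  then have nz: "p \<noteq> 0" "q \<noteq> 0" using pq by auto
  define W where "W = poly_D g p * q - p * poly_D g q"
  have "poly W y / (poly q y)\<^sup>2 = poly H y * u - a"
    using Du pq(3) unfolding H(2) unfolding pq(4) W_def
    by (simp add: poly_poly_D[OF g(2)] D_divide)
  then have "poly W y = (poly H y * u - a) * (poly q y)\<^sup>2"
    using pq(3) by (simp add: nonzero_divide_eq_eq)
  then have "poly (W - (H * p - smult a q) * q) y = 0"
    using pq(3) by (simp add: pq(4) power2_eq_square algebra_simps)
  moreover have "W - (H * p - smult a q) * q \<in> polys_over L"
    unfolding W_def using L g(1) pq H(1) abc by (intro polys_over_ring polys_over_poly_D) auto
  ultimately have "W - (H * p - smult a q) * q = 0"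
    using y by (auto simp: alg_closure_in_iff)
  then have W: "W = (H * p - smult a q) * q" by simp
  have ord: "order \<beta> q \<le> order \<beta> p" for \<beta>
  proof (rule ccontr)
    assume less: "\<not> order \<beta> q \<le> order \<beta> p"
    then have "poly q \<beta> = 0" using nz by (simp add: order_root)
    then have "\<beta> \<in> alg_closure_in L"
      using pq nz by (auto simp: alg_closure_in_iff)
    then have \<beta>: "D \<beta> \<noteq> poly g \<beta>" using nosol by (simp add: poly_g)
    \<comment> \<open>At a pole this power divides both \<open>p\<close> and \<open>q\<close>, hence
      \<open>H * p - smult a q\<close>; together with the factor \<open>q\<close> of
      \<open>W\<close> this forces equal orders, a contradiction.\<close>
    have "[:- \<beta>, 1:] ^ order \<beta> p dvd [:- \<beta>, 1:] ^ order \<beta> q"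
      using less by (intro le_imp_power_dvd) simp
    then have "[:- \<beta>, 1:] ^ order \<beta> p dvd q"
      using order_1 dvd_trans by blast
    then have "[:- \<beta>, 1:] ^ (order \<beta> p + order \<beta> q) dvd W"
      unfolding W power_add by (intro mult_dvd_mono dvd_diff dvd_mult dvd_smult order_1)
    then have "order \<beta> p = order \<beta> q"
      using order_eq_of_wronskian_dvd[OF nz \<beta>] unfolding W_def by blast
    then show False using less by simp
  qed
  obtain r where r: "p = q * r"
    using dvd_of_order_le[OF closed nz ord] by (elim dvdE)
  have "r \<noteq> 0" using nz r by auto
  have "q * q * poly_D g r = q * q * (H * r - [:a:])"
    using W unfolding W_def r poly_D_mult by (simp add: algebra_simps)
  then have "poly_D g r = H * r - [:a:]" using nz by simp
  \<comment> \<open>In this degree the left side has \<open>degree r * a\<close> and the right side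
    \<open>- 2 * a\<close>, each times the leading coefficient of \<open>r\<close>.\<close>
  then have "coeff (poly_D g r) (Suc (degree r)) = coeff (H * r - [:a:]) (Suc (degree r))"
    by simp
  moreover have "coeff (H * r - [:a:]) (Suc (degree r)) = - 2 * a * lead_coeff r"
    by (simp add: H_def coeff_eq_0)
  moreover have "coeff (poly_D g r) (Suc (degree r)) = of_nat (degree r) * a * lead_coeff r"
    by (cases "degree r")
      (simp_all add: poly_D_def g_def coeff_map_poly coeff_pderiv coeff_eq_0 algebra_simps)
  ultimately have "(of_nat (degree r) + 2) * (a * lead_coeff r) = 0"
    by (simp add: algebra_simps)
  moreover have "of_nat (degree r) + 2 \<noteq> (0 :: 'u)"
    using of_nat_neq_0[of "Suc (degree r)", where ?'a = 'u] by (simp add: algebra_simps)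
  ultimately show False using abc(4) \<open>r \<noteq> 0\<close> by simp
qed

end

section \<open>Multivariate polynomials\<close>

definition mon_eval :: "('v \<Rightarrow> 'u) \<Rightarrow> ('v \<Rightarrow>\<^sub>0 nat) \<Rightarrow> 'u::comm_semiring_1" where
  "mon_eval f m = (\<Prod>v\<in>Poly_Mapping.keys m. f v ^ Poly_Mapping.lookup m v)"

text \<open>Injectivity of \<open>r\<close> keeps distinct terms from merging.\<close>

lemma lookup_sum_single:
  assumes "finite A" "inj_on r A" "m \<in> A"
  shows "Poly_Mapping.lookup (\<Sum>m\<in>A. Poly_Mapping.single (r m) (k m)) (r m) = k m"
proof -
  have "(\<Sum>n\<in>A. k n when r n = r m) = (\<Sum>n\<in>A. if n = m then k n else 0)"
    using assms by (intro sum.cong) (auto simp: when_def inj_on_def)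
  then show ?thesis
    using assms by (simp add: lookup_sum lookup_single)
qed

lemma keys_sum_single:
  "Poly_Mapping.keys (\<Sum>m\<in>A. Poly_Mapping.single (r m) (k m)) \<subseteq> r ` A"
proof (cases "finite A")
  case True
  have "Poly_Mapping.keys (\<Sum>m\<in>A. Poly_Mapping.single (r m) (k m))
      \<subseteq> (\<Union>m\<in>A. Poly_Mapping.keys (Poly_Mapping.single (r m) (k m)))"
    by (rule keys_sum)
  also have "\<dots> \<subseteq> r ` A" by auto
  finally show ?thesis .
qed simp

lemma mpol_eval_sum_single:
  assumes "finite A" "inj_on r A"
  shows "mpol_eval f (\<Sum>m\<in>A. Poly_Mapping.single (r m) (k m)) = (\<Sum>m\<in>A. k m * mon_eval f (r m))"
proof -
  define p where "p = (\<Sum>m\<in>A. Poly_Mapping.single (r m) (k m))"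
  have "mpol_eval f p = (\<Sum>n\<in>r ` A. Poly_Mapping.lookup p n * mon_eval f n)"
    unfolding mpol_eval_def mon_eval_def p_def using assms(1)
    by (intro sum.mono_neutral_left keys_sum_single) (auto simp: in_keys_iff)
  also have "\<dots> = (\<Sum>m\<in>A. k m * mon_eval f (r m))"
    unfolding sum.reindex[OF assms(2)] p_def using assms
    by (intro sum.cong) (auto simp: lookup_sum_single)
  finally show ?thesis unfolding p_def .
qed

text \<open>Blum's axiom applied to \<open>p\<close>, read as a differential polynomial of order 0,
  and to \<open>g = 1\<close> of order -1.\<close>

lemma model_DCF0_root:
  fixes D :: "'u::field_char_0 \<Rightarrow> 'u"
    and p :: "'u poly"
  assumes "model_DCF0 D" and "degree p > 0"
  shows "\<exists>x. poly p x = 0"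
proof -
  define r :: "nat \<Rightarrow> nat \<Rightarrow>\<^sub>0 nat" where "r = Poly_Mapping.single 0"
  define f :: "'u dpol" where "f = (\<Sum>i\<le>degree p. Poly_Mapping.single (r i) (coeff p i))"
  have inj: "inj_on r A" for A
    by (intro inj_onI) (metis lookup_single_eq r_def)
  have "mpol_vars f \<subseteq> {0}"
    unfolding mpol_vars_def f_def r_def using keys_sum_single by (fastforce split: if_splits)
  \<comment> \<open>The leading monomial has positive exponent, so the variable really occurs and
    the order is 0, not -1.\<close>
  moreover have "0 \<in> mpol_vars f"
  proof -
    have "Poly_Mapping.lookup f (r (degree p)) = lead_coeff p"
      unfolding f_def using inj by (intro lookup_sum_single) auto
    then have "r (degree p) \<in> Poly_Mapping.keys f"
      using assms(2) by (auto simp: in_keys_iff)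
    then show ?thesis
      using assms(2) unfolding mpol_vars_def r_def by (auto intro!: bexI)
  qed
  ultimately have "mpol_vars f = {0}" by auto
  then have "dpol_order f = 0" by (simp add: dpol_order_def)
  moreover have "dpol_order (1 :: 'u dpol) = - 1"
    by (simp add: dpol_order_def mpol_vars_def)
  ultimately obtain x where x: "dpol_eval D f x = 0"
    using assms(1) one_neq_zero[where ?'a = "'u dpol"] unfolding model_DCF0_def
    by (metis neg_less_0_iff_less zero_less_one)
  have "mon_eval (\<lambda>i. (D ^^ i) x) (r i) = x ^ i" for i
    by (simp add: mon_eval_def r_def)
  then have "dpol_eval D f x = poly p x"
    unfolding dpol_eval_def f_def mpol_eval_sum_single[OF finite_atMost inj]
    by (simp add: poly_altdef)
  then show ?thesis using x by auto
qed

section \<open>Algebraic independence, one element at a time\<close>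

lemma alg_independent_empty: "alg_independent K {}"
  unfolding alg_independent_def
proof (intro allI impI, elim conjE)
  fix p :: "('a, 'a) mpol"
  assume "mpol_vars p \<subseteq> {}" and eval: "mpol_eval (\<lambda>s. s) p = 0"
  \<comment> \<open>Without variables only the monomial 1, whose key is 0, remains.\<close>
  then have keys: "Poly_Mapping.keys p \<subseteq> {0}"
    by (auto simp: mpol_vars_def)
  have "mpol_eval (\<lambda>s. s) p = (\<Sum>m\<in>{0}. Poly_Mapping.lookup p m * mon_eval (\<lambda>s. s) m)"
    unfolding mpol_eval_def mon_eval_def
    by (intro sum.mono_neutral_left keys) (auto simp: in_keys_iff)
  then have "Poly_Mapping.lookup p 0 = 0"
    using eval by (simp add: mon_eval_def)
  then have "0 \<notin> Poly_Mapping.keys p"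
    by (simp add: in_keys_iff)
  with keys have "Poly_Mapping.keys p = {}"
    by blast
  then show "p = 0" by simp
qed

text \<open>Sorted by powers of \<open>x\<close>, a relation becomes a univariate polynomial over
  \<open>adjoin K S\<close> with root \<open>x\<close>, hence zero. Its coefficients are then
  relations among elements of \<open>S\<close>, which are trivial.\<close>

lemma alg_independent_insert:
  assumes K: "is_subfield K" and S: "alg_independent K S"
    and x: "x \<notin> alg_closure_in (adjoin K S)"
  shows "alg_independent K (insert x S)"
  unfolding alg_independent_def
proof (intro allI impI, elim conjE)
  fix p :: "('a, 'a) mpol"
  assume vars: "mpol_vars p \<subseteq> insert x S" and coeffs: "\<forall>m. Poly_Mapping.lookup p m \<in> K"
    and eval: "mpol_eval (\<lambda>s. s) p = 0"
  let ?ev = "mon_eval (\<lambda>s. s)"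
  \<comment> \<open>\<open>r\<close> strips \<open>x\<close> from a monomial, \<open>A i\<close>
    collects the monomials of degree \<open>i\<close> in \<open>x\<close>, \<open>cf i\<close> is
    the coefficient of \<open>x ^ i\<close> as a polynomial in the other variables, and
    \<open>Q\<close> is \<open>p\<close> with those variables evaluated.\<close>
  define r where "r m = m - Poly_Mapping.single x (Poly_Mapping.lookup m x)" for m :: "'a \<Rightarrow>\<^sub>0 nat"
  define A where "A i = {m \<in> Poly_Mapping.keys p. Poly_Mapping.lookup m x = i}" for i
  define cf where "cf i = (\<Sum>m\<in>A i. Poly_Mapping.single (r m) (Poly_Mapping.lookup p m))" for i
  define Q where "Q = (\<Sum>m\<in>Poly_Mapping.keys p.
    monom (Poly_Mapping.lookup p m * ?ev (r m)) (Poly_Mapping.lookup m x))"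
  have lookup_r: "Poly_Mapping.lookup (r m) v = (if v = x then 0 else Poly_Mapping.lookup m v)"
    for m v by (simp add: r_def lookup_minus lookup_single when_def)
  have keys_r: "Poly_Mapping.keys (r m) = Poly_Mapping.keys m - {x}" for m
    by (auto simp: in_keys_iff lookup_r split: if_splits)
  have finA: "finite (A i)" for i
    by (simp add: A_def)
  have injA: "inj_on r (A i)" for i
  proof (rule inj_onI)
    fix m n assume mn: "m \<in> A i" "n \<in> A i" "r m = r n"
    show "m = n"
    proof (rule poly_mapping_eqI)
      fix v
      show "Poly_Mapping.lookup m v = Poly_Mapping.lookup n v"
        using mn lookup_r[of m v] lookup_r[of n v] by (cases "v = x") (auto simp: A_def)
    qed
  qed
  have mon: "?ev m = ?ev (r m) * x ^ Poly_Mapping.lookup m x" for m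
  proof -
    have "?ev (r m) = (\<Prod>v\<in>Poly_Mapping.keys m - {x}. v ^ Poly_Mapping.lookup m v)"
      unfolding mon_eval_def keys_r by (intro prod.cong) (auto simp: lookup_r)
    then show ?thesis
      by (cases "x \<in> Poly_Mapping.keys m")
        (auto simp: mon_eval_def in_keys_iff prod.remove mult.commute)
  qed
  have coeff_Q: "coeff Q i = mpol_eval (\<lambda>s. s) (cf i)" for i
  proof -
    have "coeff Q i = (\<Sum>m\<in>Poly_Mapping.keys p.
        if Poly_Mapping.lookup m x = i then Poly_Mapping.lookup p m * ?ev (r m) else 0)"
      unfolding Q_def by (simp add: coeff_sum)
    also have "\<dots> = (\<Sum>m\<in>A i. Poly_Mapping.lookup p m * ?ev (r m))"
      unfolding A_def by (intro sum.inter_filter[symmetric]) simp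
    finally show ?thesis
      unfolding cf_def mpol_eval_sum_single[OF finA injA] .
  qed
  have keys_in: "Poly_Mapping.keys (r m) \<subseteq> S" if "m \<in> Poly_Mapping.keys p" for m
    using vars that unfolding keys_r mpol_vars_def by auto
  have "Q \<in> polys_over (adjoin K S)"
  proof -
    note M = is_subfield_adjoin[of K S]
    have "?ev (r m) \<in> adjoin K S" if "m \<in> Poly_Mapping.keys p" for m
      unfolding mon_eval_def using keys_in[OF that] adjoin_superset(2)[of S K]
      by (intro subfield_intros[OF M]) auto
    moreover have "Poly_Mapping.lookup p m \<in> adjoin K S" for m
      using coeffs adjoin_superset(1)[of K S] by auto
    ultimately have "coeff Q i \<in> adjoin K S" for i
      unfolding coeff_Q cf_def mpol_eval_sum_single[OF finA injA]
      by (intro subfield_intros[OF M]) (auto simp: A_def)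
    then show ?thesis by (simp add: polys_over_def)
  qed
  moreover have "poly Q x = 0"
  proof -
    have "poly Q x = (\<Sum>m\<in>Poly_Mapping.keys p. Poly_Mapping.lookup p m * ?ev m)"
      unfolding Q_def by (simp add: poly_sum poly_monom mult.assoc mon[symmetric])
    then show ?thesis
      using eval by (simp add: mpol_eval_def mon_eval_def)
  qed
  ultimately have "Q = 0"
    using x by (auto simp: alg_closure_in_iff)
  have keys_cf: "Poly_Mapping.keys (cf i) \<subseteq> r ` A i" for i
    unfolding cf_def by (rule keys_sum_single)
  have cf_0: "cf i = 0" for i
  proof -
    have "mpol_vars (cf i) \<subseteq> S"
      unfolding mpol_vars_def
    proof (rule UN_least)
      fix n assume "n \<in> Poly_Mapping.keys (cf i)"
      then obtain m where "m \<in> A i" "n = r m"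
        using keys_cf[of i] by auto
      then show "Poly_Mapping.keys n \<subseteq> S" using keys_in by (auto simp: A_def)
    qed
    moreover have "Poly_Mapping.lookup (cf i) n \<in> K" for n
    proof (cases "n \<in> r ` A i")
      case True
      then obtain m where "m \<in> A i" "n = r m" by auto
      then have "Poly_Mapping.lookup (cf i) n = Poly_Mapping.lookup p m"
        unfolding cf_def by (simp only: lookup_sum_single[OF finA injA])
      then show ?thesis
        using coeffs by simp
    next
      case False
      then have "n \<notin> Poly_Mapping.keys (cf i)"
        using keys_cf[of i] by auto
      then show ?thesis using subfield_0[OF K] by (simp add: in_keys_iff)
    qed
    moreover have "mpol_eval (\<lambda>s. s) (cf i) = 0"
      using coeff_Q[of i] \<open>Q = 0\<close> by simp
    ultimately show ?thesis
      using S unfolding alg_independent_def by blast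
  qed
  have "Poly_Mapping.keys p = {}"
  proof (rule ccontr)
    assume "Poly_Mapping.keys p \<noteq> {}"
    \<comment> \<open>A monomial of \<open>p\<close> would reappear, stripped of \<open>x\<close>,
      with the same coefficient in some \<open>cf i\<close>, but these are all zero.\<close>
    then obtain m where m: "m \<in> Poly_Mapping.keys p" by blast
    then have "m \<in> A (Poly_Mapping.lookup m x)" by (simp add: A_def)
    then have "Poly_Mapping.lookup (cf (Poly_Mapping.lookup m x)) (r m) = Poly_Mapping.lookup p m"
      unfolding cf_def by (rule lookup_sum_single[OF finA injA])
    then show False using m cf_0 by (simp add: in_keys_iff)
  qed
  then show "p = 0" by simp
qed

section \<open>Solutions of the Riccati equation\<close>

theorem proposition2p5:
  fixes D :: "'u::field_char_0 \<Rightarrow> 'u"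
    and \<iota> :: "complex \<Rightarrow> 'u"
    and t a b c y0 y1 y2 :: 'u
    and K :: "'u set"
  assumes "model_DCF0 D" and "saturated D"
    and "is_field_hom \<iota>" and "range \<iota> = constants D"
    and "D t = 1"
    and "K = adjoin (range \<iota>) {t}"
    and "a \<in> K" and "b \<in> K" and "c \<in> K" and "a \<noteq> 0"
    and "\<not> (\<exists>y \<in> alg_closure_in K. D y = a * y^2 + b * y + c)"
    and "D y0 = a * y0^2 + b * y0 + c"
    and "D y1 = a * y1^2 + b * y1 + c"
    and "D y2 = a * y2^2 + b * y2 + c"
    and "y0 \<noteq> y1" and "y0 \<noteq> y2" and "y1 \<noteq> y2"
  shows "has_trdeg K (adjoin K {y0, y1, y2}) 3 \<and> alg_independent K {y0, y1, y2}"
proof -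
  interpret derivation D
    using \<open>model_DCF0 D\<close> by unfold_locales (auto simp: model_DCF0_def is_derivation_def)
  have closed: "\<forall>p :: 'u poly. degree p > 0 \<longrightarrow> (\<exists>x. poly p x = 0)"
    using model_DCF0_root[OF \<open>model_DCF0 D\<close>] by blast
  have K: "is_subfield K" "D ` K \<subseteq> K"
  proof -
    show sub: "is_subfield K" unfolding assms(6) by (rule is_subfield_adjoin)
    \<comment> \<open>The generators of \<open>K\<close> are constants and \<open>t\<close>, with
      derivatives 0 and 1.\<close>
    have "D x = 0" if "x \<in> range \<iota>" for x
      using that unfolding assms(4) by (simp add: constants_def)
    then show "D ` K \<subseteq> K"
      using subfield_0[OF sub] subfield_1[OF sub] \<open>D t = 1\<close> unfolding assms(6)
      by (intro adjoin_D_closed) auto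
  qed
  have nosol: "D \<beta> \<noteq> a * \<beta>\<^sup>2 + b * \<beta> + c" if "\<beta> \<in> alg_closure_in K" for \<beta>
    using assms(11) that by blast
  then have y0: "y0 \<notin> alg_closure_in K" using assms(12) by blast

  \<comment> \<open>The field generated by \<open>y0\<close> and the linear equations over
    it\<close>
  define L1 where "L1 = adjoin K {y0}"
  define h where "h = - (2 * a * y0 + b)"
  have K_L1: "K \<subseteq> L1" and y0_L1: "y0 \<in> L1"
    using adjoin_superset[of K "{y0}"] adjoin_superset(2)[of "{y0}" K] by (auto simp: L1_def)
  have subL1: "is_subfield L1"
    unfolding L1_def by (rule is_subfield_adjoin)
  have abc_L1: "a \<in> L1" "b \<in> L1" "c \<in> L1"
    using assms(7-9) K_L1 by auto
  have h_L1: "h \<in> L1"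
    unfolding h_def using abc_L1 y0_L1 by (intro subfield_intros[OF subL1])
  have "D y0 \<in> L1"
    unfolding assms(12) using abc_L1 y0_L1 by (intro subfield_intros[OF subL1])
  then have L1: "is_subfield L1" "D ` L1 \<subseteq> L1"
    using subL1 K K_L1 adjoin_D_closed[of K "{y0}"] by (auto simp: L1_def)
  have no_linear: "D u \<noteq> h * u + - a" if "u \<in> L1" for u
    using riccati_linearization_no_rational_solution[OF closed K y0 assms(7-10) assms(12) nosol]
      that unfolding L1_def h_def by simp
  have no_exp: "D v \<noteq> of_nat n * h * v" if "v \<in> L1" "v \<noteq> 0" "n > 0" for n v
  proof
    assume Dv: "D v = of_nat n * h * v"
    \<comment> \<open>Chosen so that its value at \<open>y0\<close> is \<open>n * h\<close>.\<close>
    define s where "s = [:- of_nat n * b, - of_nat n * 2 * a:]"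
    have "v \<in> K"
    proof (rule in_base_if_logarithmic_derivative_polynomial[OF closed K y0])
      show "[:c, b, a:] \<in> polys_over K" "s \<in> polys_over K"
        using K assms(7-9) unfolding s_def
        by (auto simp: polys_over_pCons polys_over_ring intro!: subfield_intros)
      show "D y0 = poly [:c, b, a:] y0"
        using assms(12) by (simp add: algebra_simps power2_eq_square)
      show "D \<beta> \<noteq> poly [:c, b, a:] \<beta>" if "\<beta> \<in> alg_closure_in K" for \<beta>
        using nosol[OF that] by (simp add: algebra_simps power2_eq_square)
      show "D v = poly s y0 * v"
        unfolding Dv s_def h_def by (simp add: algebra_simps)
      show "v \<in> adjoin K {y0}" using that by (simp add: L1_def)
    qed (use that in auto)
    \<comment> \<open>This quotient is \<open>h\<close>; since \<open>h\<close> is affine in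
      \<open>y0\<close> with slope \<open>- 2 * a \<noteq> 0\<close>, it would put \<open>y0\<close>
      into \<open>K\<close>.\<close>
    then have "D v / (of_nat n * v) \<in> K"
      using K by (intro subfield_intros) auto
    then have "h \<in> K" using Dv that by simp
    then have "(- h - b) / (2 * a) \<in> K"
      using K assms(7,8) by (intro subfield_intros)
    moreover have "(- h - b) / (2 * a) = y0"
      using \<open>a \<noteq> 0\<close> by (simp add: h_def)
    ultimately show False
      using y0 subset_alg_closure_in[OF K(1)] by auto
  qed
  have no_alg_linear: "D \<beta> \<noteq> h * \<beta> + - a" if "\<beta> \<in> alg_closure_in L1" for \<beta>
    using algebraic_linear_equation[OF L1 that h_L1] no_linear subfield_uminus[OF subL1]
      abc_L1(1) by metis
  have linear: "D (inverse (y - y0)) = h * inverse (y - y0) + - a"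
    if "D y = a * y\<^sup>2 + b * y + c" "y \<noteq> y0" for y
  proof -
    \<comment> \<open>The difference satisfies the Bernoulli equation
      \<open>D d = a * d^2 - h * d\<close>, which its inverse linearizes.\<close>
    define d where "d = y - y0"
    have d: "d \<noteq> 0" "y = y0 + d" using that by (auto simp: d_def)
    have "D d = d * (a * (2 * y0 + d) + b)"
      unfolding d_def D_diff that assms(12) by (simp add: algebra_simps power2_eq_square)
    then show ?thesis
      unfolding d_def[symmetric] D_inverse[OF d(1)] h_def using d(1)
      by (simp add: field_simps power2_eq_square)
  qed

  \<comment> \<open>Transcendence of \<open>u1\<close> and of the difference
    \<open>w\<close>\<close>
  define u1 u2 where "u1 = inverse (y1 - y0)" and "u2 = inverse (y2 - y0)"
  have Du: "D u1 = h * u1 + - a" "D u2 = h * u2 + - a"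
    using linear[OF assms(13)] linear[OF assms(14)] assms(15,16) by (auto simp: u1_def u2_def)
  have u1: "u1 \<notin> alg_closure_in L1"
    using no_alg_linear Du by blast
  define L2 where "L2 = adjoin L1 {u1}"
  have L1_L2: "L1 \<subseteq> L2" and u1_L2: "u1 \<in> L2"
    using adjoin_superset(1)[of L1 "{u1}"] adjoin_superset(2)[of "{u1}" L1] by (auto simp: L2_def)
  have subL2: "is_subfield L2"
    unfolding L2_def by (rule is_subfield_adjoin)
  have "D u1 \<in> L2"
    unfolding Du using L1_L2 h_L1 u1_L2 abc_L1 by (intro subfield_intros[OF subL2]) auto
  then have L2: "is_subfield L2" "D ` L2 \<subseteq> L2"
    using subL2 L1 L1_L2 adjoin_D_closed[of L1 "{u1}"] by (auto simp: L2_def)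
  \<comment> \<open>Subtracting cancels the inhomogeneous term \<open>- a\<close>.\<close>
  define w where "w = u2 - u1"
  have "w \<noteq> 0" using assms(15-17) by (auto simp: w_def u1_def u2_def)
  have Dw: "D w = h * w"
    unfolding w_def D_diff Du by (simp add: algebra_simps)
  have w: "w \<notin> alg_closure_in L2"
  proof
    assume "w \<in> alg_closure_in L2"
    then obtain n v where v: "n > 0" "v \<in> L2" "v \<noteq> 0" "D v = of_nat n * h * v"
      using algebraic_exponential[OF L2 _ \<open>w \<noteq> 0\<close> _ Dw] h_L1 L1_L2 by blast
    \<comment> \<open>The norm \<open>v\<close> descends from \<open>L2\<close> to \<open>L1\<close>
      by the same zero-pole argument, now in the variable \<open>u1\<close>, whose linear equation
      has no solution algebraic over \<open>L1\<close>.\<close>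
    have "v \<in> L1"
    proof (rule in_base_if_logarithmic_derivative_polynomial[OF closed L1 u1])
      show "[:- a, h:] \<in> polys_over L1" "[:of_nat n * h:] \<in> polys_over L1"
        using L1 h_L1 abc_L1
        by (auto simp: polys_over_pCons polys_over_ring intro!: subfield_intros)
      show "D u1 = poly [:- a, h:] u1" using Du by (simp add: algebra_simps)
      show "D \<beta> \<noteq> poly [:- a, h:] \<beta>" if "\<beta> \<in> alg_closure_in L1" for \<beta>
        using no_alg_linear[OF that] by (simp add: algebra_simps)
    qed (use v in \<open>auto simp: L2_def\<close>)
    then show False using no_exp v by blast
  qed

  \<comment> \<open>Return from \<open>u1\<close> and \<open>w\<close> to \<open>y1\<close> and
    \<open>y2\<close>\<close>
  have y1: "y1 \<notin> alg_closure_in L1"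
  proof
    assume "y1 \<in> alg_closure_in L1"
    then have "inverse (y1 + - y0) \<in> alg_closure_in L1"
      using subL1 y0_L1 by (intro alg_closure_in_inverse alg_closure_in_add subfield_uminus)
    then show False using u1 by (simp add: u1_def)
  qed
  have y2: "y2 \<notin> alg_closure_in L2"
  proof
    assume "y2 \<in> alg_closure_in L2"
    \<comment> \<open>This element is \<open>w\<close>.\<close>
    then have "inverse (y2 + - y0) + - u1 \<in> alg_closure_in L2"
      using subL2 y0_L1 L1_L2 u1_L2
      by (intro alg_closure_in_inverse alg_closure_in_add subfield_uminus) auto
    then show False using w by (simp add: w_def u2_def)
  qed
  have "adjoin K {y1, y0} \<subseteq> L2"
  proof (rule adjoin_minimal[OF subL2])
    \<comment> \<open>This element is \<open>y1\<close>.\<close>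
    have "y0 + inverse u1 \<in> L2"
      using y0_L1 L1_L2 u1_L2 by (intro subfield_intros[OF subL2]) auto
    then show "{y1, y0} \<subseteq> L2"
      using y0_L1 L1_L2 by (auto simp: u1_def)
  qed (use K_L1 L1_L2 in auto)
  then have "y2 \<notin> alg_closure_in (adjoin K {y1, y0})"
    using y2 alg_closure_in_mono by blast
  moreover have "y0 \<notin> alg_closure_in (adjoin K {})"
    using y0 adjoin_minimal[OF K(1), of K "{}"] alg_closure_in_mono by blast
  \<comment> \<open>The solutions are inserted in the order \<open>y0\<close>, \<open>y1\<close>,
    \<open>y2\<close>, each transcendental over the field generated by the earlier ones.\<close>
  ultimately have "alg_independent K {y2, y1, y0}"
    using y1 K(1) unfolding L1_def
    by (intro alg_independent_insert alg_independent_empty)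
  then have ind: "alg_independent K {y0, y1, y2}"
    by (simp add: insert_commute)
  have "transcendence_basis K (adjoin K {y0, y1, y2}) {y0, y1, y2}"
    unfolding transcendence_basis_def
    using ind adjoin_superset(2)[of "{y0, y1, y2}" K] subset_alg_closure_in[OF is_subfield_adjoin]
    by blast
  moreover have "card {y0, y1, y2} = 3"
    using assms(15-17) by simp
  ultimately show ?thesis
    using ind unfolding has_trdeg_def by blast
qed

end
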